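(* Let $\mathcal{R}$ and $\mathcal{U}$ be quasiassociative algebras over a commutative ring $K$ and let $\chi:Lie(\mathcal{R})\to\mathrm{Der}(\mathcal{U})$ be a representation (a Lie algebra homomorphism); write $a.u=\chi(a)(u)$. Define the semidirect sum of $\mathcal{R}$ and $\mathcal{U}$ with respect to $\chi$ as the space $\mathcal{R}\oplus\mathcal{U}$ with the multiplication $$\begin{pmatrix} a \\ u \end{pmatrix}*\begin{pmatrix} b \\ v \end{pmatrix}=\begin{pmatrix} a*b \\ a.v+u*v \end{pmatrix},\qquad a,b\in\mathcal{R},\quad u,v\in\mathcal{U}.$$ Then this multiplication is quasiassociative.
   Context: An algebra with bilinear multiplication $*$ is quasiassociative if $a*(b*c)-(a*b)*c=b*(a*c)-(b*a)*c$ for all elements $a,b,c$. $Lie(\mathcal{R})$ is the Lie algebra on $\mathcal{R}$ with bracket $[a,b]=a*b-b*a$. $\mathrm{Der}(\mathcal{U})$ is the Lie algebra of derivations of the algebra $(\mathcal{U},* )$, i.e. linear maps $D$ with $D(u*v)=D(u)*v+u*D(v)$. *)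

theory Defs
  imports "HOL-Analysis.Product_Vector" "HOL-Library.Function_Algebras"
begin

(* K, R and U are types with scalar multiplications given by the library locale module.
   Bilinear multiplications are not assumed associative or unital, so they are explicit
   parameters and not the overloaded times. *)

locale bilinear_algebra = module smult
  for smult :: "'k::comm_ring_1 \<Rightarrow> 'a::ab_group_add \<Rightarrow> 'a" +
  fixes mult :: "'a \<Rightarrow> 'a \<Rightarrow> 'a"
  assumes linear_left: "module_hom smult smult (\<lambda>a. mult a b)"
    and linear_right: "module_hom smult smult (\<lambda>b. mult a b)"

locale quasiassociative_algebra = bilinear_algebra +
  assumes quasiassociative:
    "mult a (mult b c) - mult (mult a b) c = mult b (mult a c) - mult (mult b a) c"

(* commutator applied to the multiplication of R is the bracket of Lie(R);
   applied to composition it is the bracket of Der(U). *)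
definition commutator :: "('a \<Rightarrow> 'a \<Rightarrow> 'a::minus) \<Rightarrow> 'a \<Rightarrow> 'a \<Rightarrow> 'a" where
  "commutator p a b = p a b - p b a"

definition derivations ::
  "('k::comm_ring_1 \<Rightarrow> 'u::ab_group_add \<Rightarrow> 'u) \<Rightarrow> ('u \<Rightarrow> 'u \<Rightarrow> 'u) \<Rightarrow> ('u \<Rightarrow> 'u) set" where
  "derivations smult mult =
     {D. module_hom smult smult D \<and> (\<forall>u v. D (mult u v) = mult (D u) v + mult u (D v))}"

definition pointwise_scale :: "('k \<Rightarrow> 'u \<Rightarrow> 'u) \<Rightarrow> 'k \<Rightarrow> ('a \<Rightarrow> 'u) \<Rightarrow> 'a \<Rightarrow> 'u" where
  "pointwise_scale smult k f = (\<lambda>x. smult k (f x))"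

(* Lie algebra homomorphisms Lie(R) -> Der(U). Linearity is stated in the module of all
   functions U -> U, which contains Der(U) as a submodule. *)
locale derivation_representation =
  module_hom smultR "pointwise_scale smultU" \<chi>
  for smultR :: "'k::comm_ring_1 \<Rightarrow> 'r::ab_group_add \<Rightarrow> 'r"
    and multR :: "'r \<Rightarrow> 'r \<Rightarrow> 'r"
    and smultU :: "'k \<Rightarrow> 'u::ab_group_add \<Rightarrow> 'u"
    and multU :: "'u \<Rightarrow> 'u \<Rightarrow> 'u"
    and \<chi> :: "'r \<Rightarrow> 'u \<Rightarrow> 'u" +
  assumes derivation: "\<chi> a \<in> derivations smultU multU"
    and bracket: "\<chi> (commutator multR a b) = commutator (\<circ>) (\<chi> a) (\<chi> b)"

definition semidirect_mult ::
  "('r \<Rightarrow> 'r \<Rightarrow> 'r) \<Rightarrow> ('u \<Rightarrow> 'u \<Rightarrow> 'u::plus) \<Rightarrow> ('r \<Rightarrow> 'u \<Rightarrow> 'u) \<Rightarrow> 'r \<times> 'u \<Rightarrow> 'r \<times> 'u \<Rightarrow> 'r \<times> 'u" where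
  "semidirect_mult multR multU \<chi> = (\<lambda>(a, u) (b, v). (multR a b, \<chi> a v + multU u v))"

end

(* By the Leibniz rule, the second component of the associator x * (y * z) - (x * y) * z
   is a.(b.w) - (a * b).w + v * (a.w) + u * (b.w) plus the associator of u, v, w. The difference
   of the first two terms is symmetric under exchanging a and b because chi preserves brackets,
   and the last one is symmetric in u and v because U is quasiassociative. *)
theory Submission
  imports Defs
begin

theorem propositionA2p2:
  fixes smultR :: "'k::comm_ring_1 \<Rightarrow> 'r::ab_group_add \<Rightarrow> 'r"
    and multR :: "'r \<Rightarrow> 'r \<Rightarrow> 'r"
    and smultU :: "'k \<Rightarrow> 'u::ab_group_add \<Rightarrow> 'u"
    and multU :: "'u \<Rightarrow> 'u \<Rightarrow> 'u"
    and \<chi> :: "'r \<Rightarrow> 'u \<Rightarrow> 'u"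
  assumes "quasiassociative_algebra smultR multR"
    and "quasiassociative_algebra smultU multU"
    and "derivation_representation smultR multR smultU multU \<chi>"
  shows "quasiassociative_algebra (module_prod.scale smultR smultU) (semidirect_mult multR multU \<chi>)"
proof -
  interpret R: quasiassociative_algebra smultR multR by fact
  interpret U: quasiassociative_algebra smultU multU by fact
  interpret \<chi>: derivation_representation smultR multR smultU multU \<chi> by fact
  interpret P: module_prod smultR smultU ..
  note R_left = module_hom.add[OF R.linear_left] module_hom.scale[OF R.linear_left]
  note R_right = module_hom.add[OF R.linear_right] module_hom.scale[OF R.linear_right]
  note U_left = module_hom.add[OF U.linear_left] module_hom.scale[OF U.linear_left]
  note U_right = module_hom.add[OF U.linear_right] module_hom.scale[OF U.linear_right]
  have \<chi>_hom: "module_hom smultU smultU (\<chi> a)" for a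
    using \<chi>.derivation[of a] by (simp add: derivations_def)
  note \<chi>_right = module_hom.add[OF \<chi>_hom] module_hom.scale[OF \<chi>_hom]
  have \<chi>_left: "\<chi> (a + b) u = \<chi> a u + \<chi> b u" "\<chi> (smultR k a) u = smultU k (\<chi> a u)" for a b k u
    by (simp_all add: \<chi>.add \<chi>.scale pointwise_scale_def)
  have leibniz: "\<chi> a (multU u v) = multU (\<chi> a u) v + multU u (\<chi> a v)" for a u v
    using \<chi>.derivation[of a] by (simp add: derivations_def)
  \<comment> \<open>Preservation of brackets, rearranged so that each side is the other with
    \<open>a\<close> and \<open>b\<close> exchanged. This is the shape in which the action of R
    enters the associator.\<close>
  have \<chi>_bracket: "\<chi> a (\<chi> b w) - \<chi> (multR a b) w = \<chi> b (\<chi> a w) - \<chi> (multR b a) w" for a b w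
  proof -
    have "\<chi> (multR a b) w = \<chi> (multR a b - multR b a) w + \<chi> (multR b a) w"
      by (metis \<chi>_left(1) diff_add_cancel)
    also have "\<chi> (multR a b - multR b a) w = \<chi> a (\<chi> b w) - \<chi> b (\<chi> a w)"
      using fun_cong[OF \<chi>.bracket[of a b], of w] by (simp add: commutator_def)
    finally show ?thesis by (simp add: algebra_simps)
  qed
  let ?m = "semidirect_mult multR multU \<chi>"
  note prod_simps = semidirect_mult_def P.scale_def case_prod_unfold prod_eq_iff
  show ?thesis
  \<comment> \<open>The interpretation \<open>P\<close> supplies the module axioms of the direct
    sum. Bilinearity in the left factor needs \<open>\<chi>\<close> linear, in the right factor each
    \<open>\<chi> a\<close> linear.\<close>
  proof (unfold_locales, goal_cases)
    case (1 b x y) then show ?case by (simp add: prod_simps R_left U_left \<chi>_left add_ac)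
  next
    case (2 b k x) then show ?case by (simp add: prod_simps R_left U_left \<chi>_left U.scale_right_distrib)
  next
    case (3 a x y) then show ?case by (simp add: prod_simps R_right U_right \<chi>_right add_ac)
  next
    case (4 a k x) then show ?case by (simp add: prod_simps R_right U_right \<chi>_right U.scale_right_distrib)
  next
    case (5 x y z)
    obtain a u b v c w where xyz: "x = (a, u)" "y = (b, v)" "z = (c, w)"
      by (cases x, cases y, cases z)
    \<comment> \<open>The Leibniz rule for \<open>\<chi> a (multU v w)\<close> yields
      \<open>multU (\<chi> a v) w\<close>, which cancels against the same term of the product
      bracketed to the left.\<close>
    have associator: "snd (?m (a, u) (?m (b, v) (c, w)) - ?m (?m (a, u) (b, v)) (c, w)) =
        (\<chi> a (\<chi> b w) - \<chi> (multR a b) w) + (multU v (\<chi> a w) + multU u (\<chi> b w))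
        + (multU u (multU v w) - multU (multU u v) w)" for a b c u v w
      by (simp add: semidirect_mult_def leibniz U_left U_right \<chi>_right algebra_simps)
    show ?case
      \<comment> \<open>The laws are instantiated at \<open>a b\<close> and \<open>u v\<close> so
        that they rewrite one side into the other without looping. The mixed products then differ
        only in the order of summands.\<close>
      unfolding xyz prod_eq_iff associator \<chi>_bracket[of a b] U.quasiassociative[of u v]
      by (simp add: semidirect_mult_def R.quasiassociative[of a b] add.commute)
  qed
qed

end
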